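(* For every integer $n\ge 1$, $$(-1)^n(2n)!\left(2^{2n+1}-1\right)\frac{\zeta(2n+1)}{(2\pi)^{2n}}=\int_0^1\int_0^\infty K_t(x)\,e^{-x}\,p_n(x)\,dx\,dt,$$ where $\zeta$ is the Riemann zeta function.
   Context: $K_\nu$ is the modified Bessel function of the second kind; for $x>0$, $K_t(x)=\int_0^\infty e^{-x\cosh u}\cosh(tu)\,du$. The polynomials $p_n$, $n\ge 0$, are defined by $p_n(x)=(-1)^n e^x\mathcal A^n e^{-x}$, where $\mathcal A$ is the differential operator $\mathcal A f(x)=x^2f(x)-x\frac{d}{dx}\left(x\frac{df}{dx}\right)$; thus $p_0(x)=1$, $p_1(x)=-x$, $p_2(x)=3x^2-x$. *)

theory Defs
  imports "HOL-Analysis.Analysis"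
begin

text \<open>Dirichlet series of the Riemann zeta function, meaningful for \<open>s > 1\<close> only; no analytic
  continuation is involved.\<close>

definition zeta :: "real \<Rightarrow> real" where
  "zeta s = (\<Sum>k. 1 / real (Suc k) powr s)"

text \<open>Integral representation of the modified Bessel function of the second kind, of real order
  \<open>t\<close>, meaningful for \<open>x > 0\<close> only.\<close>

definition bessel_K :: "real \<Rightarrow> real \<Rightarrow> real" where
  "bessel_K t x = (LBINT u:{0..}. exp (- x * cosh u) * cosh (t * u))"

definition op_A :: "(real \<Rightarrow> real) \<Rightarrow> real \<Rightarrow> real" where
  "op_A f x = x\<^sup>2 * f x - x * deriv (\<lambda>y. y * deriv f y) x"

definition p_fun :: "nat \<Rightarrow> real \<Rightarrow> real" where
  "p_fun n x = (-1) ^ n * exp x * (op_A ^^ n) (\<lambda>y. exp (- y)) x"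

end

theory Submission
  imports Defs "HOL-Probability.Sinc_Integral"
begin

text \<open>The identity reduces to a one-dimensional integral of an iterated derivative of \<open>tanh\<close>, whose poles
  produce the zeta value.

  The operator \<open>\<A>\<close> acts on \<open>exp (-x cosh u)\<close>, as a function of \<open>x\<close>, like \<open>-d\<^sup>2/du\<^sup>2\<close>. Hence
  \<open>p\<^sub>n(x) e\<^sup>-\<^sup>x\<close> is the \<open>2n\<close>-th \<open>u\<close>-derivative of \<open>exp (-x cosh u)\<close> at \<open>u = 0\<close>. Inserting
  \<open>K\<^sub>t(x) = \<integral> exp (-x cosh v) cosh (t v) dv\<close> and integrating over \<open>x\<close> first leads to the
  \<open>u\<close>-derivatives of
  \<open>1 / (cosh u + cosh v) = (tanh ((v + u)/2) + tanh ((v - u)/2)) / (2 sinh v)\<close>, whose value at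
  \<open>u = 0\<close> is \<open>T\<^sub>n(v) / sinh v\<close> with \<open>T\<^sub>n(v) = (d/dv)\<^sup>2\<^sup>n tanh (v/2)\<close>. Since
  \<open>\<integral>\<^sub>0\<^sup>1 cosh (t v) dt = sinh v / v\<close>, the right-hand side equals \<open>\<integral>\<^sub>0\<^sup>\<infinity> T\<^sub>n(v) / v dv\<close>
  (\<open>bessel_double_integral\<close>). In the formal proof the auxiliary variable \<open>u\<close> does not occur: the
  coefficients of \<open>p\<^sub>n\<close> satisfy a recursion which says for the Laplace transforms that
  \<open>T\<^sub>n'' = T\<^sub>n\<^sub>+\<^sub>1\<close> (\<open>tanh_kernel_second_derivative\<close>).

  The partial fraction expansion of \<open>tanh (v/2)\<close>, obtained from the reflection formula for the Digamma
  function (\<open>pole_sum_1\<close>), can be differentiated termwise and gives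
  \<open>T\<^sub>n(v) = 4 (2n)! \<Sum>\<^sub>k Re (v - \<i>a\<^sub>k)\<^sup>-\<^sup>2\<^sup>n\<^sup>-\<^sup>1\<close> with \<open>a\<^sub>k = (2k + 1)\<pi>\<close>
  (\<open>tanh_kernel_eq_pole_sum\<close>). Each term contributes
  \<open>\<integral>\<^sub>0\<^sup>\<infinity> Re (v - \<i>a)\<^sup>-\<^sup>2\<^sup>n\<^sup>-\<^sup>1 / v dv = (-1)\<^sup>n (\<pi>/2) / a\<^sup>2\<^sup>n\<^sup>+\<^sup>1\<close>
  (\<open>pole_integrand_integral\<close>), and summing over the odd numbers \<open>2k + 1\<close> yields
  \<open>(1 - 2\<^sup>-\<^sup>2\<^sup>n\<^sup>-\<^sup>1) \<zeta>(2n + 1)\<close>.\<close>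

section \<open>The coefficients of the polynomials\<close>

text \<open>On \<open>x\<^sup>k e\<^sup>-\<^sup>x\<close> the operator \<open>-\<A>\<close> produces
  \<open>(k\<^sup>2 x\<^sup>k - (2k + 1) x\<^sup>k\<^sup>+\<^sup>1) e\<^sup>-\<^sup>x\<close>; comparing coefficients gives this recursion.\<close>

fun p_coeff :: "nat \<Rightarrow> nat \<Rightarrow> real" where
  "p_coeff 0 k = (if k = 0 then 1 else 0)"
| "p_coeff (Suc n) k =
     (real k)\<^sup>2 * p_coeff n k - (if k = 0 then 0 else (2 * real k - 1) * p_coeff n (k - 1))"

lemma p_coeff_eq_0: "n < k \<Longrightarrow> p_coeff n k = 0"
  by (induction n arbitrary: k) auto

text \<open>For \<open>n \<ge> 1\<close> the polynomial \<open>p\<^sub>n\<close> vanishes at the origin. This cancels the singularity of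
  \<open>K\<^sub>1\<close> there, and makes all later integrals converge absolutely up to \<open>t = 1\<close>.\<close>

lemma p_coeff_at_0: "n \<ge> 1 \<Longrightarrow> p_coeff n 0 = 0"
  by (cases n) auto

text \<open>The recursion in transposed form, for an arbitrary sequence \<open>m\<close> in place of the monomials: with
  \<open>m k = x\<^sup>k\<close> it describes the action of \<open>-\<A>\<close>, with \<open>m k = k! / b\<^sup>k\<^sup>+\<^sup>1\<close> that of
  \<open>d\<^sup>2/dv\<^sup>2\<close> on the Laplace transforms.\<close>

lemma sum_p_coeff_Suc:
  "(\<Sum>k\<le>Suc n. p_coeff (Suc n) k * m k)
     = (\<Sum>k\<le>n. p_coeff n k * ((real k)\<^sup>2 * m k - (2 * real k + 1) * m (Suc k)))"
proof -
  have "(\<Sum>k\<le>Suc n. p_coeff (Suc n) k * m k)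
      = (\<Sum>k\<le>Suc n. (real k)\<^sup>2 * p_coeff n k * m k)
        - (\<Sum>k\<le>Suc n. (if k = 0 then 0 else (2 * real k - 1) * p_coeff n (k - 1)) * m k)"
    unfolding sum_subtractf [symmetric] by (intro sum.cong) (auto simp: algebra_simps)
  also have "(\<Sum>k\<le>Suc n. (real k)\<^sup>2 * p_coeff n k * m k) = (\<Sum>k\<le>n. (real k)\<^sup>2 * p_coeff n k * m k)"
    by (simp add: p_coeff_eq_0)
  also have "(\<Sum>k\<le>Suc n. (if k = 0 then 0 else (2 * real k - 1) * p_coeff n (k - 1)) * m k)
      = (\<Sum>k\<le>n. (2 * real k + 1) * p_coeff n k * m (Suc k))"
    by (subst sum.atMost_Suc_shift) (auto intro!: sum.cong simp: algebra_simps)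
  finally show ?thesis
    by (simp add: sum_subtractf [symmetric] algebra_simps)
qed

lemma has_real_derivative_exp_minus_times_poly:
  fixes c :: "nat \<Rightarrow> real"
  shows "((\<lambda>x. exp (- x) * (\<Sum>k\<le>n. c k * x ^ k)) has_real_derivative
           exp (- x) * ((\<Sum>k\<le>n. c k * (real k * x ^ (k - 1))) - (\<Sum>k\<le>n. c k * x ^ k))) (at x)"
  by (auto intro!: derivative_eq_intros simp: algebra_simps)

lemma op_A_exp_minus_times_poly:
  fixes c :: "nat \<Rightarrow> real"
  shows "op_A (\<lambda>x. exp (- x) * (\<Sum>k\<le>n. c k * x ^ k)) x
     = - exp (- x) * (\<Sum>k\<le>n. c k * ((real k)\<^sup>2 * x ^ k - (2 * real k + 1) * x ^ Suc k))"
proof -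
  have *: "x * (x ^ (k - 1) * real k) = x ^ k * real k" for x :: real and k
    by (cases k) auto
  have **: "x * (\<Sum>k\<le>n. d k * (real k * x ^ (k - 1))) = (\<Sum>k\<le>n. d k * (real k * x ^ k))"
    for d :: "nat \<Rightarrow> real" and x
    unfolding sum_distrib_left
    by (intro sum.cong refl) (metis * mult.assoc mult.commute)
  define S where "S = (\<lambda>x. \<Sum>k\<le>n. c k * x ^ k)"
  define S1 where "S1 = (\<lambda>x. \<Sum>k\<le>n. (c k * real k) * x ^ k)"
  define S2 where "S2 = (\<lambda>x. \<Sum>k\<le>n. (c k * (real k)\<^sup>2) * x ^ k)"
  have d: "(\<lambda>y. y * deriv (\<lambda>x. exp (- x) * S x) y) = (\<lambda>y. exp (- y) * S1 y - y * (exp (- y) * S y))"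
  proof
    fix y
    have "deriv (\<lambda>x. exp (- x) * S x) y = exp (- y) * ((\<Sum>k\<le>n. c k * (real k * y ^ (k - 1))) - S y)"
      unfolding S_def by (rule DERIV_imp_deriv[OF has_real_derivative_exp_minus_times_poly])
    then have "y * deriv (\<lambda>x. exp (- x) * S x) y
        = exp (- y) * (y * (\<Sum>k\<le>n. c k * (real k * y ^ (k - 1)))) - y * (exp (- y) * S y)"
      by (simp only: right_diff_distrib mult.left_commute[of y])
    then show "y * deriv (\<lambda>x. exp (- x) * S x) y = exp (- y) * S1 y - y * (exp (- y) * S y)"
      unfolding **[of y c] by (simp add: S1_def mult.assoc)
  qed
  define A1 where "A1 = (\<Sum>k\<le>n. c k * (real k * x ^ (k - 1)))"
  define A2 where "A2 = (\<Sum>k\<le>n. (c k * real k) * (real k * x ^ (k - 1)))"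
  have A: "S1 x = x * A1" "S2 x = x * A2"
    using **[of x c] **[of x "\<lambda>k. c k * real k"]
    by (simp_all add: A1_def A2_def S1_def S2_def power2_eq_square mult.assoc)
  have "((\<lambda>y. exp (- y) * S1 y - y * (exp (- y) * S y)) has_real_derivative
      exp (- x) * (A2 - S1 x) - (x * (exp (- x) * (A1 - S x)) + 1 * (exp (- x) * S x))) (at x)"
    unfolding S_def S1_def A1_def A2_def
    by (intro DERIV_diff DERIV_mult' DERIV_ident has_real_derivative_exp_minus_times_poly)
  then have "deriv (\<lambda>y. exp (- y) * S1 y - y * (exp (- y) * S y)) x
      = exp (- x) * (A2 - S1 x) - (x * (exp (- x) * (A1 - S x)) + 1 * (exp (- x) * S x))"
    by (rule DERIV_imp_deriv)
  then have "x * deriv (\<lambda>y. exp (- y) * S1 y - y * (exp (- y) * S y)) x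
      = exp (- x) * (S2 x - 2 * x * S1 x - x * S x + x\<^sup>2 * S x)"
    by (simp only: A) (simp add: algebra_simps power2_eq_square)
  then have "op_A (\<lambda>x. exp (- x) * S x) x = - exp (- x) * (S2 x - 2 * x * S1 x - x * S x)"
    unfolding op_A_def d by (simp add: algebra_simps)
  also have "S2 x - 2 * x * S1 x - x * S x
      = (\<Sum>k\<le>n. c k * ((real k)\<^sup>2 * x ^ k - (2 * real k + 1) * x ^ Suc k))"
    unfolding S_def S1_def S2_def sum_distrib_left sum_subtractf[symmetric]
    by (intro sum.cong) (auto simp: algebra_simps)
  finally show ?thesis
    unfolding S_def .
qed

lemma op_A_funpow_exp_minus:
  "(op_A ^^ n) (\<lambda>y. exp (- y)) = (\<lambda>x. exp (- x) * (\<Sum>k\<le>n. ((-1) ^ n * p_coeff n k) * x ^ k))"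
proof (induction n)
  case (Suc n)
  have "(op_A ^^ Suc n) (\<lambda>y. exp (- y)) x
      = exp (- x) * (\<Sum>k\<le>Suc n. ((-1) ^ Suc n * p_coeff (Suc n) k) * x ^ k)" for x
  proof -
    have "(op_A ^^ Suc n) (\<lambda>y. exp (- y)) x = - exp (- x) *
        (\<Sum>k\<le>n. ((-1) ^ n * p_coeff n k) * ((real k)\<^sup>2 * x ^ k - (2 * real k + 1) * x ^ Suc k))"
      unfolding funpow.simps o_apply Suc.IH by (rule op_A_exp_minus_times_poly)
    also have "\<dots> = exp (- x) * ((-1) ^ Suc n * (\<Sum>k\<le>n. p_coeff n k *
        ((real k)\<^sup>2 * x ^ k - (2 * real k + 1) * x ^ Suc k)))"
      by (simp add: sum_distrib_left mult_ac)
    also have "\<dots> = exp (- x) * (\<Sum>k\<le>Suc n. ((-1) ^ Suc n * p_coeff (Suc n) k) * x ^ k)"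
      unfolding sum_p_coeff_Suc [symmetric] by (simp only: sum_distrib_left mult.assoc)
    finally show ?thesis .
  qed
  then show ?case by blast
qed simp

lemma p_fun_eq_sum: "p_fun n x = (\<Sum>k\<le>n. p_coeff n k * x ^ k)"
proof -
  have "p_fun n x = (exp x * exp (- x)) * (((-1) ^ n * (-1) ^ n) * (\<Sum>k\<le>n. p_coeff n k * x ^ k))"
    unfolding p_fun_def op_A_funpow_exp_minus mult.assoc sum_distrib_left [symmetric]
    by (simp add: mult_ac)
  also have "exp x * exp (- x) = 1" by (simp add: exp_minus)
  also have "(-1) ^ n * (-1) ^ n = (1::real)" by (simp flip: power_mult_distrib)
  finally show ?thesis by simp
qed

section \<open>The Laplace transform of p as an iterated derivative of tanh\<close>

text \<open>The value \<open>\<integral>\<^sub>0\<^sup>\<infinity> exp (-(1 + cosh v) x) p\<^sub>n(x) dx\<close>, integrated monomial by monomial.\<close>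

definition laplace_p :: "nat \<Rightarrow> real \<Rightarrow> real" where
  "laplace_p n v = (\<Sum>k\<le>n. p_coeff n k * (fact k / (1 + cosh v) ^ Suc k))"

text \<open>This is \<open>(d/dv)\<^sup>2\<^sup>n tanh (v/2)\<close>: the case \<open>n = 0\<close> is the half-angle formula, and the step
  from \<open>n\<close> to \<open>n + 1\<close> is two differentiations.\<close>

definition tanh_kernel :: "nat \<Rightarrow> real \<Rightarrow> real" where
  "tanh_kernel n v = sinh v * laplace_p n v"

lemma one_plus_cosh_pos: "1 + cosh (v::real) > 0"
  using cosh_real_pos[of v] by linarith

lemma sinh_sq: "sinh (v::real) * sinh v = (1 + cosh v) * (cosh v - 1)"
  using cosh_square_eq[of v] by (simp add: power2_eq_square algebra_simps)

lemma has_real_derivative_inverse_power_one_plus_cosh: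
  "((\<lambda>v. c / (1 + cosh v) ^ k) has_real_derivative
      - (c * real k * sinh v / (1 + cosh v) ^ Suc k)) (at v)"
proof -
  have "1 + cosh v \<noteq> 0" using one_plus_cosh_pos[of v] by simp
  then have "((\<lambda>v. c * inverse (1 + cosh v) ^ k) has_real_derivative
      c * (real k * (- (inverse (1 + cosh v) * sinh v * inverse (1 + cosh v))
        * inverse (1 + cosh v) ^ (k - 1)))) (at v)"
    by (auto intro!: derivative_eq_intros)
  then show ?thesis
    by (cases k) (simp_all add: divide_inverse power_inverse mult_ac)
qed

text \<open>With \<open>b = 1 + cosh v\<close> one has \<open>sinh\<^sup>2 v = b (b - 2)\<close> and \<open>cosh v = b - 1\<close>, so the derivative
  involves \<open>v\<close> through \<open>b\<close> alone; one more differentiation restores the factor \<open>sinh v\<close>.\<close>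

lemma has_real_derivative_sinh_div_power:
  "((\<lambda>v. sinh v / (1 + cosh v) ^ Suc k) has_real_derivative
      (2 * real k + 1) / (1 + cosh v) ^ Suc k - real k / (1 + cosh v) ^ k) (at v)"
proof -
  have "((\<lambda>v. sinh v * (1 / (1 + cosh v) ^ Suc k)) has_real_derivative
      sinh v * - (1 * real (Suc k) * sinh v / (1 + cosh v) ^ Suc (Suc k))
      + cosh v * (1 / (1 + cosh v) ^ Suc k)) (at v)"
    by (intro DERIV_mult' has_real_derivative_inverse_power_one_plus_cosh)
       (auto intro!: derivative_eq_intros)
  also have "sinh v * - (1 * real (Suc k) * sinh v / (1 + cosh v) ^ Suc (Suc k))
      = - (real (Suc k) * (sinh v * sinh v) / (1 + cosh v) ^ Suc (Suc k))"
    by simp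
  also have "\<dots> + cosh v * (1 / (1 + cosh v) ^ Suc k)
      = (2 * real k + 1) / (1 + cosh v) ^ Suc k - real k / (1 + cosh v) ^ k"
  proof -
    define b where "b = 1 + cosh v"
    have c: "cosh v = b - 1" "1 + (b - 1) = b" "b \<noteq> 0"
      using one_plus_cosh_pos[of v] by (auto simp: b_def)
    show ?thesis unfolding sinh_sq c(1,2) using c(3) by (simp add: field_simps)
  qed
  finally show ?thesis by simp
qed

lemma has_real_derivative_diff_inverse_powers:
  "((\<lambda>v. (2 * real k + 1) / (1 + cosh v) ^ Suc k - real k / (1 + cosh v) ^ k) has_real_derivative
      sinh v * ((real k)\<^sup>2 / (1 + cosh v) ^ Suc k
                - (2 * real k + 1) * (real k + 1) / (1 + cosh v) ^ Suc (Suc k))) (at v)"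
  by (rule DERIV_cong[OF DERIV_diff[OF has_real_derivative_inverse_power_one_plus_cosh
        has_real_derivative_inverse_power_one_plus_cosh]])
     (simp add: algebra_simps power2_eq_square diff_divide_distrib add_divide_distrib)

lemma tanh_kernel_second_derivative:
  obtains D where "\<And>v. (tanh_kernel n has_real_derivative D v) (at v)"
    and "\<And>v. (D has_real_derivative tanh_kernel (Suc n) v) (at v)"
proof
  let ?D = "\<lambda>v. \<Sum>k\<le>n. (p_coeff n k * fact k) *
      ((2 * real k + 1) / (1 + cosh v) ^ Suc k - real k / (1 + cosh v) ^ k)"
  have "tanh_kernel n = (\<lambda>v. \<Sum>k\<le>n. (p_coeff n k * fact k) * (sinh v / (1 + cosh v) ^ Suc k))"
    by (auto simp: fun_eq_iff tanh_kernel_def laplace_p_def sum_distrib_left mult_ac)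
  then show "(tanh_kernel n has_real_derivative ?D v) (at v)" for v
    by (simp only:) (intro DERIV_sum DERIV_cmult has_real_derivative_sinh_div_power)
  have "tanh_kernel (Suc n) v = (\<Sum>k\<le>n. (p_coeff n k * fact k) *
      (sinh v * ((real k)\<^sup>2 / (1 + cosh v) ^ Suc k
                - (2 * real k + 1) * (real k + 1) / (1 + cosh v) ^ Suc (Suc k))))" for v
    unfolding tanh_kernel_def laplace_p_def sum_p_coeff_Suc sum_distrib_left
    by (intro sum.cong) (auto simp: algebra_simps diff_divide_distrib add_divide_distrib)
  then show "(?D has_real_derivative tanh_kernel (Suc n) v) (at v)" for v
    by (simp only:) (intro DERIV_sum DERIV_cmult has_real_derivative_diff_inverse_powers)
qed

section \<open>Partial fractions\<close>

definition pole_sum :: "nat \<Rightarrow> real \<Rightarrow> real" where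
  "pole_sum m v = (\<Sum>k. Re (1 / (Complex v (- (real (2 * k + 1) * pi))) ^ m))"

lemma norm_Complex_ge: "norm (Complex v c) \<ge> \<bar>c\<bar>"
  using abs_Im_le_cmod[of "Complex v c"] by simp

lemma odd_pi_ge: "real (2 * k + 1) * pi \<ge> real (Suc k)"
proof -
  have "real (Suc k) * 1 \<le> real (2 * k + 1) * pi"
    using pi_gt3 by (intro mult_mono) auto
  then show ?thesis by simp
qed

text \<open>A majorant independent of \<open>v\<close>, valid from the second power on. It justifies differentiating the
  series termwise, and later exchanging it with the integral.\<close>

lemma pole_term_bound:
  assumes "m \<ge> 2"
  shows "\<bar>Re (1 / (Complex v (- (real (2 * k + 1) * pi))) ^ m)\<bar> \<le> 1 / real (Suc k) ^ 2"
proof -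
  define z where "z = Complex v (- (real (2 * k + 1) * pi))"
  have z: "norm z \<ge> real (Suc k)"
    using norm_Complex_ge[of "- (real (2 * k + 1) * pi)" v] odd_pi_ge[of k] unfolding z_def by linarith
  then have z1: "norm z \<ge> 1" by simp
  have "\<bar>Re (1 / z ^ m)\<bar> \<le> 1 / norm z ^ m"
    using abs_Re_le_cmod[of "1 / z ^ m"] by (simp add: norm_divide norm_power)
  also have "\<dots> \<le> 1 / norm z ^ 2"
    using z1 assms by (intro divide_left_mono power_increasing mult_pos_pos zero_less_power) auto
  also have "\<dots> \<le> 1 / real (Suc k) ^ 2"
    using z z1 by (intro divide_left_mono power_mono mult_pos_pos zero_less_power) auto
  finally show ?thesis unfolding z_def .
qed

lemma summable_inverse_Suc_square: "summable (\<lambda>k. 1 / real (Suc k) ^ 2)"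
  using inverse_power_summable[of 2, where 'a = real] 
  by (subst summable_Suc_iff) (simp add: inverse_eq_divide)

lemma has_real_derivative_Re_pole:
  assumes "c \<noteq> 0"
  shows "((\<lambda>v. Re (1 / Complex v c ^ m)) has_real_derivative
           - (real m * Re (1 / Complex v c ^ Suc m))) (at v)"
proof -
  have eq: "Complex v c = of_real v + \<i> * of_real c" for v
    by (simp add: complex_eq_iff)
  have nz: "of_real v + \<i> * of_real c \<noteq> 0"
    using assms by (simp add: complex_eq_iff)
  have "((\<lambda>z. inverse (z + \<i> * of_real c) ^ m) has_field_derivative
      of_nat m * (- (inverse (of_real v + \<i> * of_real c) * 1 * inverse (of_real v + \<i> * of_real c))
        * inverse (of_real v + \<i> * of_real c) ^ (m - 1))) (at (of_real v))"
    using nz by (auto intro!: derivative_eq_intros)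
  also have "of_nat m * (- (inverse (of_real v + \<i> * of_real c) * 1 * inverse (of_real v + \<i> * of_real c))
        * inverse (of_real v + \<i> * of_real c) ^ (m - 1))
      = - (of_nat m * inverse (of_real v + \<i> * of_real c) ^ Suc m)"
    by (cases m) simp_all
  finally have "((\<lambda>z. inverse (z + \<i> * of_real c) ^ m) has_field_derivative
      - (of_nat m * inverse (of_real v + \<i> * of_real c) ^ Suc m)) (at (of_real v))" .
  then have "((\<lambda>v. inverse (of_real v + \<i> * of_real c) ^ m) has_vector_derivative
      - (of_nat m * inverse (of_real v + \<i> * of_real c) ^ Suc m)) (at v)"
    by (rule has_vector_derivative_real_field)
  then have "((\<lambda>v. Re (inverse (of_real v + \<i> * of_real c) ^ m)) has_vector_derivative
      Re (- (of_nat m * inverse (of_real v + \<i> * of_real c) ^ Suc m))) (at v)"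
    by (rule bounded_linear.has_vector_derivative[OF bounded_linear_Re])
  then show ?thesis
    unfolding has_real_derivative_iff_has_vector_derivative eq
    by (simp add: divide_inverse power_inverse)
qed

lemma
  assumes "m \<ge> 1"
  shows summable_pole_sum: "summable (\<lambda>k. Re (1 / (Complex v (- (real (2 * k + 1) * pi))) ^ m))"
    and has_real_derivative_pole_sum:
      "(pole_sum m has_real_derivative - (real m * pole_sum (Suc m) v)) (at v)"
proof -
  define f where "f = (\<lambda>m k v. Re (1 / (Complex v (- (real (2 * k + 1) * pi))) ^ m))"
  have bound: "norm (f m k v) \<le> 1 / real (Suc k) ^ 2" if "m \<ge> 2" for m k v
    using pole_term_bound[OF that, of v k] unfolding f_def by simp
  have summ: "summable (\<lambda>k. f m k v)" if "m \<ge> 2" for m v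
    by (rule summable_comparison_test'[OF summable_inverse_Suc_square bound]) (use that in auto)
  have ucv: "uniformly_convergent_on UNIV (\<lambda>n v. \<Sum>k<n. - (real m * f (Suc m) k v))"
  proof (rule Weierstrass_m_test'_ev)
    show "\<forall>\<^sub>F k in sequentially. \<forall>v\<in>UNIV. norm (- (real m * f (Suc m) k v)) \<le> real m * (1 / real (Suc k) ^ 2)"
    proof (intro always_eventually allI ballI)
      fix k v
      show "norm (- (real m * f (Suc m) k v)) \<le> real m * (1 / real (Suc k) ^ 2)"
        unfolding norm_minus_cancel norm_mult real_norm_def[of "real m"] abs_of_nat
        using assms by (intro mult_left_mono bound) auto
    qed
    show "summable (\<lambda>k. real m * (1 / real (Suc k) ^ 2))"
      by (intro summable_mult summable_inverse_Suc_square)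
  qed
  \<comment> \<open>The first powers are not dominated uniformly in \<open>v\<close>, but their series converges trivially at 0,
    where each pole term is purely imaginary.\<close>
  have summ0: "summable (\<lambda>k. f m k 0)"
  proof (cases "m = 1")
    case True
    then show ?thesis by (simp add: f_def Re_divide)
  next
    case False
    then show ?thesis using assms by (intro summ) auto
  qed
  have der: "(f m k has_field_derivative - (real m * f (Suc m) k v)) (at v within UNIV)" for k v
    unfolding f_def by (rule has_real_derivative_Re_pole) simp
  note * = has_field_derivative_series'[OF convex_UNIV der ucv UNIV_I summ0, of v, simplified interior_UNIV, OF UNIV_I]
  show "summable (\<lambda>k. Re (1 / (Complex v (- (real (2 * k + 1) * pi))) ^ m))"
    using *(1) unfolding f_def .
  have "(\<Sum>k. - (real m * f (Suc m) k v)) = - (real m * (\<Sum>k. f (Suc m) k v))"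
    using summ[of "Suc m" v] assms by (simp add: suminf_minus suminf_mult summable_mult)
  with *(2) show "(pole_sum m has_real_derivative - (real m * pole_sum (Suc m) v)) (at v)"
    unfolding f_def pole_sum_def by simp
qed

text \<open>The logarithmic derivative of \<open>\<Gamma>(1/2 + z) \<Gamma>(1/2 - z) = \<pi> / cos (\<pi> z)\<close>, written with the entire
  function \<open>1/\<Gamma>\<close> and cleared of the denominator.\<close>

lemma Digamma_half_reflection:
  fixes z :: complex
  assumes "1/2 + z \<notin> \<int>\<^sub>\<le>\<^sub>0" "1/2 - z \<notin> \<int>\<^sub>\<le>\<^sub>0"
  shows "cos (of_real pi * z) * (Digamma (1/2 + z) - Digamma (1/2 - z)) = of_real pi * sin (of_real pi * z)"
proof -
  have eq: "rGamma (1/2 + z) * rGamma (1/2 - z) = cos (of_real pi * z) / of_real pi" for z :: complex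
    using rGamma_reflection_complex[of "1/2 + z"]
    by (simp add: ring_distribs sin_add sin_of_real[symmetric] cos_of_real[symmetric])
  have "((\<lambda>z. rGamma (1/2 + z) * rGamma (1/2 - z)) has_field_derivative
      rGamma (1/2 + z) * (- rGamma (1/2 - z) * Digamma (1/2 - z) * (-1))
      + (- rGamma (1/2 + z) * Digamma (1/2 + z) * 1) * rGamma (1/2 - z)) (at z)"
    using assms
    by (intro DERIV_mult' DERIV_chain2[OF has_field_derivative_rGamma_no_nonpos_int])
       (auto intro!: derivative_eq_intros)
  moreover have "((\<lambda>z. rGamma (1/2 + z) * rGamma (1/2 - z)) has_field_derivative
      - sin (of_real pi * z)) (at z)"
    unfolding eq by (auto intro!: derivative_eq_intros)
  ultimately have "rGamma (1/2 + z) * rGamma (1/2 - z) * (Digamma (1/2 + z) - Digamma (1/2 - z)) = sin (of_real pi * z)"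
    by (auto dest: DERIV_unique simp: algebra_simps)
  then show ?thesis
    unfolding eq by (simp add: field_simps)
qed

text \<open>The partial fraction expansion of \<open>tanh (v/2)\<close>: at \<open>z = \<i>v/(2\<pi>)\<close> the series for the two Digamma
  values in the reflection formula combine into the poles at \<open>\<plusminus>\<i>(2k + 1)\<pi>\<close>.\<close>

lemma pole_sum_1: "4 * pole_sum 1 v = sinh v / (1 + cosh v)"
proof -
  define w where "w = v / (2 * pi)"
  define z where "z = \<i> * complex_of_real w"
  have nonint: "1/2 + z \<notin> \<int>\<^sub>\<le>\<^sub>0" "1/2 - z \<notin> \<int>\<^sub>\<le>\<^sub>0" "1/2 + z \<noteq> 0" "1/2 - z \<noteq> 0"
    by (auto simp: z_def complex_eq_iff elim!: nonpos_Ints_cases)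
  have "(\<lambda>k. inverse (1/2 - z + of_nat k) - inverse (1/2 + z + of_nat k)) sums
      (Digamma (1/2 + z) - Digamma (1/2 - z))"
    using sums_diff[OF summable_sums[OF summable_Digamma[OF nonint(3)]]
        summable_sums[OF summable_Digamma[OF nonint(4)]]]
    by (simp add: Digamma_def)
  also have "(\<lambda>k. inverse (1/2 - z + of_nat k) - inverse (1/2 + z + of_nat k))
      = (\<lambda>k. \<i> * of_real (4 * pi * Re (1 / Complex v (- (real (2 * k + 1) * pi)) ^ 1)))"
  proof
    fix k
    define x where "x = real k + 1/2"
    have "x > 0" by (simp add: x_def)
    then have pos: "x\<^sup>2 + w\<^sup>2 > 0" by (simp add: add_pos_nonneg)
    have "inverse (1/2 - z + of_nat k) - inverse (1/2 + z + of_nat k)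
        = inverse (Complex x (- w)) - inverse (Complex x w)"
      by (intro arg_cong2[of _ _ _ _ minus] arg_cong[of _ _ inverse])
         (simp_all add: complex_eq_iff z_def x_def)
    also have "\<dots> = \<i> * of_real (2 * w / (x\<^sup>2 + w\<^sup>2))"
      by (simp add: complex_eq_iff)
    also have "2 * w / (x\<^sup>2 + w\<^sup>2) = 4 * pi * (v / (v\<^sup>2 + (2 * pi * x)\<^sup>2))"
    proof -
      have v: "v = 2 * pi * w" by (simp add: w_def)
      have "v\<^sup>2 + (2 * pi * x)\<^sup>2 = (2 * pi)\<^sup>2 * (x\<^sup>2 + w\<^sup>2)"
        unfolding v power_mult_distrib by (simp add: algebra_simps)
      then have "4 * pi * (v / (v\<^sup>2 + (2 * pi * x)\<^sup>2))
          = ((2 * pi)\<^sup>2 * (2 * w)) / ((2 * pi)\<^sup>2 * (x\<^sup>2 + w\<^sup>2))"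
        by (simp only: times_divide_eq_right) (simp add: v power2_eq_square)
      also have "\<dots> = 2 * w / (x\<^sup>2 + w\<^sup>2)"
        by (rule mult_divide_mult_cancel_left) simp
      finally show ?thesis ..
    qed
    also have "v / (v\<^sup>2 + (2 * pi * x)\<^sup>2) = Re (1 / Complex v (- (real (2 * k + 1) * pi)) ^ 1)"
      by (simp add: Re_divide x_def power2_eq_square algebra_simps)
    finally show "inverse (1/2 - z + of_nat k) - inverse (1/2 + z + of_nat k)
      = \<i> * of_real (4 * pi * Re (1 / Complex v (- (real (2 * k + 1) * pi)) ^ 1))" .
  qed
  finally have 1: "(\<lambda>k. \<i> * of_real (4 * pi * Re (1 / Complex v (- (real (2 * k + 1) * pi)) ^ 1)))
      sums (Digamma (1/2 + z) - Digamma (1/2 - z))" .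
  have 2: "(\<lambda>k. \<i> * of_real (4 * pi * Re (1 / Complex v (- (real (2 * k + 1) * pi)) ^ 1)))
      sums (\<i> * of_real (4 * pi * pole_sum 1 v))"
    unfolding pole_sum_def
    by (intro sums_mult sums_of_real summable_sums summable_pole_sum) simp
  have D: "Digamma (1/2 + z) - Digamma (1/2 - z) = \<i> * of_real (4 * pi * pole_sum 1 v)"
    using sums_unique2[OF 1 2] .
  have cos_eq: "cos (\<i> * complex_of_real y) = of_real (cosh y)" for y
    by (simp add: cos_i_times cosh_field_def exp_minus flip: exp_of_real)
  have sin_eq: "sin (\<i> * complex_of_real y) = \<i> * of_real (sinh y)" for y
    by (simp add: sin_i_times sinh_field_def exp_minus flip: exp_of_real)
  have piz: "of_real pi * z = \<i> * of_real (v / 2)"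
    by (simp add: z_def w_def)
  have "of_real (cosh (v / 2)) * (\<i> * of_real (4 * pi * pole_sum 1 v)) = of_real pi * (\<i> * of_real (sinh (v / 2)))"
    using Digamma_half_reflection[OF nonint(1,2)] unfolding D piz cos_eq sin_eq .
  then have "\<i> * of_real (pi * (cosh (v / 2) * (4 * pole_sum 1 v))) = \<i> * of_real (pi * sinh (v / 2))"
    by (simp add: mult_ac)
  then have "cosh (v / 2) * (4 * pole_sum 1 v) = sinh (v / 2)"
    unfolding mult_cancel_left of_real_eq_iff by simp
  moreover have "sinh v * cosh (v / 2) = sinh (v / 2) * (1 + cosh v)"
  proof -
    have c: "1 + cosh v = 2 * (cosh (v / 2))\<^sup>2"
      using cosh_double[of "v/2"] cosh_square_eq[of "v/2"] by simp
    show ?thesis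
      unfolding c using sinh_double[of "v/2"] by (simp add: power2_eq_square)
  qed
  ultimately have "cosh (v / 2) * (4 * pole_sum 1 v * (1 + cosh v)) = cosh (v / 2) * sinh v"
    by (metis mult.assoc mult.commute)
  then have "4 * pole_sum 1 v * (1 + cosh v) = sinh v"
    by simp
  then show ?thesis
    using one_plus_cosh_pos[of v] by (simp add: eq_divide_eq)
qed

lemma tanh_kernel_eq_pole_sum:
  "tanh_kernel n = (\<lambda>v. 4 * fact (2 * n) * pole_sum (2 * n + 1) v)"
proof (induction n)
  case 0
  show ?case using pole_sum_1 by (simp add: fun_eq_iff tanh_kernel_def laplace_p_def)
next
  case (Suc n)
  obtain D where D: "\<And>v. (tanh_kernel n has_real_derivative D v) (at v)"
    "\<And>v. (D has_real_derivative tanh_kernel (Suc n) v) (at v)"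
    using tanh_kernel_second_derivative[of n] by blast
  have "(tanh_kernel n has_real_derivative
      4 * fact (2 * n) * - (real (2 * n + 1) * pole_sum (2 * n + 2) v)) (at v)" for v
    using DERIV_cmult[OF has_real_derivative_pole_sum[of "2 * n + 1" v], of "4 * fact (2 * n)"]
    unfolding Suc.IH by simp
  from DERIV_unique[OF D(1) this]
  have "D = (\<lambda>v. (- (4 * fact (2 * n) * real (2 * n + 1))) * pole_sum (2 * n + 2) v)"
    by (simp add: fun_eq_iff)
  then have "(D has_real_derivative (- (4 * fact (2 * n) * real (2 * n + 1))) *
      - (real (2 * n + 2) * pole_sum (2 * n + 3) v)) (at v)" for v
    using DERIV_cmult[OF has_real_derivative_pole_sum[of "2 * n + 2" v], 
        of "- (4 * fact (2 * n) * real (2 * n + 1))"] 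
    by (simp add: eval_nat_numeral)
  with D(2) have "tanh_kernel (Suc n) v = (- (4 * fact (2 * n) * real (2 * n + 1))) *
      - (real (2 * n + 2) * pole_sum (2 * n + 3) v)" for v
    by (rule DERIV_unique)
  then show ?case by (simp add: fun_eq_iff algebra_simps eval_nat_numeral)
qed

section \<open>The contribution of a single pole\<close>

definition pole_integrand :: "nat \<Rightarrow> real \<Rightarrow> real \<Rightarrow> real" where
  "pole_integrand m a v = Re (1 / Complex v (- a) ^ m) / v"

text \<open>Dividing by \<open>v\<close> prevents a direct antiderivative. Since \<open>v = z + \<i>\<close> for \<open>z = v - \<i>\<close>, the factor
  \<open>v\<close> divides \<open>1 + z\<^sup>2\<close>, so that the sum of the integrands for the exponents \<open>m + 2\<close> and \<open>m\<close> is a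
  combination of powers of \<open>z\<close>, which has one.\<close>

lemma pole_integrand_recurrence:
  assumes "v \<noteq> 0"
  shows "pole_integrand (m + 2) 1 v + pole_integrand m 1 v
    = Re (1 / Complex v (-1) ^ (m + 1) - \<i> / Complex v (-1) ^ (m + 2))"
proof -
  define z where "z = Complex v (-1)"
  have z: "z \<noteq> 0" "of_real v = z + \<i>" by (auto simp: z_def complex_eq_iff)
  have "1 / z ^ (m + 2) + 1 / z ^ m = (z + \<i>) * (1 / z ^ (m + 1) - \<i> / z ^ (m + 2))"
    using z(1) by (simp add: field_simps)
  also have "\<dots> = of_real v * (1 / z ^ (m + 1) - \<i> / z ^ (m + 2))"
    unfolding z(2) ..
  finally have "Re (1 / z ^ (m + 2)) + Re (1 / z ^ m) = v * Re (1 / z ^ (m + 1) - \<i> / z ^ (m + 2))"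
    by (metis plus_complex.sel(1) Re_complex_of_real Im_complex_of_real times_complex.sel(1) mult_zero_left diff_zero)
  then show ?thesis using assms unfolding pole_integrand_def z_def[symmetric]
    by (simp add: field_simps)
qed

lemma I0i_has_bochner_integral_inverse_one_plus_square:
  "has_bochner_integral lborel (\<lambda>v. indicator {0<..} v *\<^sub>R (1 / (1 + v\<^sup>2))) (pi / 2)"
  using integrable_I0i_1_div_plus_square LBINT_I0i_1_div_plus_square
  unfolding interval_lebesgue_integral_0_infty set_integrable_def set_lebesgue_integral_def
  by (simp add: has_bochner_integral_iff)

text \<open>The antiderivative \<open>G\<close> tends to 0 at infinity, and \<open>G(0)\<close> is purely imaginary, because up to real
  factors it consists of
  an odd power of \<open>\<i>\<close> and of \<open>\<i>\<close> times an even power.\<close>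

lemma even_pole_difference_integral:
  assumes "n \<ge> 1"
  shows "has_bochner_integral lborel (\<lambda>v. indicator {0<..} v *\<^sub>R
     Re (1 / Complex v (-1) ^ (2 * n) - \<i> / Complex v (-1) ^ (2 * n + 1))) 0"
proof -
  define g where "g = (\<lambda>v. 1 / Complex v (-1) ^ (2 * n) - \<i> / Complex v (-1) ^ (2 * n + 1))"
  define G where "G = (\<lambda>v. - (1 / (of_nat (2 * n - 1) * Complex v (-1) ^ (2 * n - 1))) 
      + \<i> / (of_nat (2 * n) * Complex v (-1) ^ (2 * n)))"
  have eq: "Complex v (-1) = of_real v - \<i>" for v by (simp add: complex_eq_iff)
  have nrm: "norm (Complex v (-1)) ^ 2 = 1 + v\<^sup>2" for v
    by (simp add: cmod_power2)
  have nrm1: "norm (Complex v (-1)) \<ge> 1" for v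
    using norm_Complex_ge[of "-1" v] by simp
  have bound: "norm (1 / Complex v (-1) ^ k) \<le> 1 / (1 + v\<^sup>2)" if "k \<ge> 2" for k v
  proof -
    have "1 + v\<^sup>2 \<le> norm (Complex v (-1)) ^ k"
      unfolding nrm[symmetric] using that nrm1 by (intro power_increasing)
    moreover have "1 + v\<^sup>2 > 0" by (simp add: add_pos_nonneg)
    ultimately show ?thesis by (simp add: norm_divide norm_power frac_le)
  qed
  have nz: "complex_of_real v - \<i> \<noteq> 0" "complex_of_real v \<noteq> \<i>" for v
    by (simp_all add: complex_eq_iff)
  have cont: "continuous_on UNIV g"
    unfolding g_def eq by (intro continuous_intros) (simp_all add: nz)
  have gb: "norm (g v) \<le> 2 / (1 + v\<^sup>2)" for v
  proof -
    have "norm (g v) \<le> norm (1 / Complex v (-1) ^ (2 * n)) + norm (\<i> / Complex v (-1) ^ (2 * n + 1))"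
      unfolding g_def by (rule norm_triangle_ineq4)
    also have "norm (\<i> / Complex v (-1) ^ (2 * n + 1)) = norm (1 / Complex v (-1) ^ (2 * n + 1))"
      by (simp add: norm_divide norm_mult)
    also have "norm (1 / Complex v (-1) ^ (2 * n)) + norm (1 / Complex v (-1) ^ (2 * n + 1))
        \<le> 1 / (1 + v\<^sup>2) + 1 / (1 + v\<^sup>2)"
      using assms by (intro add_mono bound) auto
    finally show ?thesis by simp
  qed
  have int: "set_integrable lborel {0<..} g"
    unfolding set_integrable_def
  proof (rule Bochner_Integration.integrable_bound)
    show "integrable lborel (\<lambda>v. 2 * (indicator {0<..} v *\<^sub>R (1 / (1 + v\<^sup>2))) :: real)"
      using I0i_has_bochner_integral_inverse_one_plus_square
      by (intro integrable_mult_right) (auto simp: has_bochner_integral_iff)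
    have "g \<in> borel_measurable borel" by (rule borel_measurable_continuous_onI[OF cont])
    then show "(\<lambda>v. indicator {0<..} v *\<^sub>R g v) \<in> borel_measurable lborel" by simp
    show "AE v in lborel. norm (indicator {0<..} v *\<^sub>R g v) \<le> norm (2 * (indicator {0<..} v *\<^sub>R (1 / (1 + v\<^sup>2))) :: real)"
      using gb by (auto split: split_indicator)
  qed
  have der: "(G has_vector_derivative g v) (at v)" for v
  proof -
    have pw: "((\<lambda>z. - (1 / (of_nat k * (z - \<i>) ^ k))) has_field_derivative 1 / (of_real v - \<i>) ^ Suc k) (at (of_real v))"
      if "k \<ge> 1" for k
    proof -
      have "((\<lambda>z. - (1 / of_nat k) * inverse (z - \<i>) ^ k) has_field_derivative
         - (1 / of_nat k) * (of_nat k * (- (inverse (of_real v - \<i>) * 1 * inverse (of_real v - \<i>))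
           * inverse (of_real v - \<i>) ^ (k - 1)))) (at (of_real v))"
        using nz[of v] by (auto intro!: derivative_eq_intros)
      also have "- (1 / of_nat k) * (of_nat k * (- (inverse (of_real v - \<i>) * 1 * inverse (of_real v - \<i>))
           * inverse (of_real v - \<i>) ^ (k - 1))) = 1 / (of_real v - \<i>) ^ Suc k"
        using that by (cases k) (simp_all add: divide_inverse power_inverse del: of_nat_Suc)
      finally show ?thesis by (simp add: divide_inverse power_inverse mult_ac)
    qed
    have "((\<lambda>z. - (1 / (of_nat (2 * n - 1) * (z - \<i>) ^ (2 * n - 1)))
        + (- \<i>) * - (1 / (of_nat (2 * n) * (z - \<i>) ^ (2 * n)))) has_field_derivative
        1 / (of_real v - \<i>) ^ Suc (2 * n - 1) + (- \<i>) * (1 / (of_real v - \<i>) ^ Suc (2 * n))) (at (of_real v))"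
      using assms by (intro DERIV_add DERIV_cmult pw) auto
    then have "((\<lambda>z. - (1 / (of_nat (2 * n - 1) * (of_real z - \<i>) ^ (2 * n - 1)))
        + (- \<i>) * - (1 / (of_nat (2 * n) * (of_real z - \<i>) ^ (2 * n)))) has_vector_derivative
        1 / (of_real v - \<i>) ^ Suc (2 * n - 1) + (- \<i>) * (1 / (of_real v - \<i>) ^ Suc (2 * n))) (at v)"
      by (rule has_vector_derivative_real_field)
    then show ?thesis
      using assms unfolding G_def g_def eq by (simp add: Suc_diff_le)
  qed
  have lim0: "((G \<circ> real_of_ereal) \<longlongrightarrow> G 0) (at_right 0)"
  proof -
    have "continuous (at 0) G"
      using der[of 0] by (rule has_vector_derivative_continuous)
    then have "(G \<longlongrightarrow> G 0) (at_right 0)"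
      by (meson continuous_at_imp_continuous_at_within continuous_within)
    then show ?thesis
      unfolding zero_ereal_def ereal_tendsto_simps .
  qed
  have liminf: "((G \<circ> real_of_ereal) \<longlongrightarrow> 0) (at_left \<infinity>)"
  proof -
    have f: "filterlim (\<lambda>v. Complex v (-1)) at_infinity at_top"
      unfolding filterlim_at_infinity_conv_norm_at_top
      by (rule filterlim_at_top_mono[OF filterlim_ident])
         (auto intro!: always_eventually order_trans[OF abs_ge_self] abs_Re_le_cmod[of "Complex _ _", simplified])
    have g: "((\<lambda>v. 1 / Complex v (-1)) \<longlongrightarrow> 0) at_top"
      using filterlim_compose[OF tendsto_inverse_0 f] by (simp add: divide_inverse)
    have h: "((\<lambda>v. c * (1 / Complex v (-1)) ^ k) \<longlongrightarrow> 0) at_top" if "k \<ge> 1" for c k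
      using tendsto_mult[OF tendsto_const[of c] tendsto_power[OF g, of k]] that by (simp add: power_0_left)
    have "((\<lambda>v. (- 1 / of_nat (2 * n - 1)) * (1 / Complex v (-1)) ^ (2 * n - 1) 
        + (\<i> / of_nat (2 * n)) * (1 / Complex v (-1)) ^ (2 * n)) \<longlongrightarrow> 0 + 0) at_top"
      using assms by (intro tendsto_add h) auto
    then have "(G \<longlongrightarrow> 0) at_top"
      unfolding G_def by (simp add: power_divide mult_ac)
    then show ?thesis by (simp add: ereal_tendsto_simps)
  qed
  have "(LBINT v=0..\<infinity>. g v) = 0 - G 0"
  proof (rule interval_integral_FTC_integrable[OF _ der _ _ lim0 liminf])
    show "isCont g v" for v
      using cont by (simp add: continuous_on_eq_continuous_at)
    show "set_integrable lborel (einterval 0 \<infinity>) g"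
      using int by (simp add: einterval_def greaterThan_def)
  qed simp
  then have "has_bochner_integral lborel (\<lambda>v. indicator {0<..} v *\<^sub>R g v) (- G 0)"
    using int unfolding interval_lebesgue_integral_0_infty set_integrable_def set_lebesgue_integral_def
    by (simp add: has_bochner_integral_iff)
  from has_bochner_integral_Re[OF this]
  have "has_bochner_integral lborel (\<lambda>v. indicator {0<..} v *\<^sub>R Re (g v)) (- Re (G 0))"
    by simp
  moreover have "Re (G 0) = 0"
  proof -
    have e: "(Complex 0 (-1)) ^ (2 * k) = of_real ((-1) ^ k)" for k
      by (simp add: power_mult power2_eq_square complex_eq_iff flip: of_real_minus of_real_power)
    have o: "(Complex 0 (-1)) ^ (2 * n - 1) = - \<i> * of_real ((-1) ^ (n - 1))"
    proof -
      have "2 * n - 1 = Suc (2 * (n - 1))" using assms by simp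
      then show ?thesis unfolding power_Suc using e[of "n - 1"] by (simp add: complex_eq_iff)
    qed
    show ?thesis
      unfolding G_def e o by (simp add: Re_divide)
  qed
  ultimately show ?thesis unfolding g_def by simp
qed

text \<open>By the recurrence, raising the exponent by two only changes the sign; the first case is the arctangent
  integral.\<close>

lemma pole_integrand_integral_one:
  "has_bochner_integral lborel (\<lambda>v. indicator {0<..} v *\<^sub>R pole_integrand (2 * n + 1) 1 v) ((-1) ^ n * (pi / 2))"
proof (induction n)
  case 0
  have "indicator {0<..} v *\<^sub>R pole_integrand (2 * 0 + 1) 1 v = indicator {0<..} v *\<^sub>R (1 / (1 + v\<^sup>2))" for v :: real
    by (auto simp: pole_integrand_def Re_divide add.commute split: split_indicator)
  then show ?case using I0i_has_bochner_integral_inverse_one_plus_square by simp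
next
  case (Suc n)
  have "has_bochner_integral lborel (\<lambda>v. indicator {0<..} v *\<^sub>R
       Re (1 / Complex v (-1) ^ (2 * Suc n) - \<i> / Complex v (-1) ^ (2 * Suc n + 1))
       - indicator {0<..} v *\<^sub>R pole_integrand (2 * n + 1) 1 v) (0 - (-1) ^ n * (pi / 2))"
    by (rule has_bochner_integral_diff[OF even_pole_difference_integral Suc]) simp
  also have "(\<lambda>v. indicator {0<..} v *\<^sub>R
       Re (1 / Complex v (-1) ^ (2 * Suc n) - \<i> / Complex v (-1) ^ (2 * Suc n + 1))
       - indicator {0<..} v *\<^sub>R pole_integrand (2 * n + 1) 1 v)
     = (\<lambda>v. indicator {0<..} v *\<^sub>R pole_integrand (2 * Suc n + 1) 1 v)"
  proof
    fix v :: real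
    show "indicator {0<..} v *\<^sub>R
       Re (1 / Complex v (-1) ^ (2 * Suc n) - \<i> / Complex v (-1) ^ (2 * Suc n + 1))
       - indicator {0<..} v *\<^sub>R pole_integrand (2 * n + 1) 1 v
       = indicator {0<..} v *\<^sub>R pole_integrand (2 * Suc n + 1) 1 v"
    proof (cases "v > 0")
      case True
      then show ?thesis using pole_integrand_recurrence[of v "2 * n + 1"] by simp
    qed simp
  qed
  finally show ?case by simp
qed

lemma pole_integrand_scale:
  assumes "a > 0"
  shows "pole_integrand m a (a * v) = pole_integrand m 1 v / a ^ (m + 1)"
proof -
  have "Complex (a * v) (- a) = of_real a * Complex v (-1)" by (simp add: complex_eq_iff)
  then have "1 / Complex (a * v) (- a) ^ m = of_real (1 / a ^ m) * (1 / Complex v (-1) ^ m)"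
    by (simp add: power_mult_distrib)
  then have "Re (1 / Complex (a * v) (- a) ^ m) = (1 / a ^ m) * Re (1 / Complex v (-1) ^ m)"
    by (metis Re_complex_of_real Im_complex_of_real times_complex.sel(1) mult_zero_left diff_zero)
  then show ?thesis by (simp add: pole_integrand_def)
qed

text \<open>Scaling \<open>v\<close> by \<open>a\<close>. The integral of the absolute value scales in the same way, which is what makes
  the sum over all poles absolutely convergent.\<close>

lemma pole_integrand_integral:
  assumes "a > 0"
  shows "has_bochner_integral lborel (\<lambda>v. indicator {0<..} v *\<^sub>R pole_integrand (2 * n + 1) a v)
          ((-1) ^ n * (pi / 2) / a ^ (2 * n + 1))"
    and "(\<integral>v. norm (indicator {0<..} v *\<^sub>R pole_integrand (2 * n + 1) a v) \<partial>lborel)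
         = (\<integral>v. norm (indicator {0<..} v *\<^sub>R pole_integrand (2 * n + 1) 1 v) \<partial>lborel) / a ^ (2 * n + 1)"
proof -
  have ind: "indicator {0<..} (0 + a * v) = (indicator {0<..} v :: real)" for v
    using assms by (simp add: indicator_def zero_less_mult_iff)
  have sc: "indicator {0<..} (0 + a * v) *\<^sub>R pole_integrand (2 * n + 1) a (0 + a * v)
      = (indicator {0<..} v *\<^sub>R pole_integrand (2 * n + 1) 1 v) / a ^ (2 * n + 2)" for v
    unfolding ind using pole_integrand_scale[OF assms, of "2 * n + 1" v] by simp
  have "has_bochner_integral lborel (\<lambda>v. indicator {0<..} (0 + a * v) *\<^sub>R pole_integrand (2 * n + 1) a (0 + a * v))
     ((-1) ^ n * (pi / 2) / a ^ (2 * n + 2))"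
    unfolding sc by (intro has_bochner_integral_divide_zero pole_integrand_integral_one)
  moreover have "(-1) ^ n * (pi / 2) / a ^ (2 * n + 2) = ((-1) ^ n * (pi / 2) / a ^ (2 * n + 1)) /\<^sub>R \<bar>a\<bar>"
    using assms by (simp add: field_simps)
  ultimately show "has_bochner_integral lborel (\<lambda>v. indicator {0<..} v *\<^sub>R pole_integrand (2 * n + 1) a v)
          ((-1) ^ n * (pi / 2) / a ^ (2 * n + 1))"
    using assms by (subst lborel_has_bochner_integral_real_affine_iff[of a _ _ 0]) auto
  show "(\<integral>v. norm (indicator {0<..} v *\<^sub>R pole_integrand (2 * n + 1) a v) \<partial>lborel)
         = (\<integral>v. norm (indicator {0<..} v *\<^sub>R pole_integrand (2 * n + 1) 1 v) \<partial>lborel) / a ^ (2 * n + 1)"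
    using assms
    by (subst lborel_integral_real_affine[of a _ 0], simp, subst sc)
       (simp add: abs_mult field_simps)
qed

section \<open>Reduction to a single integral\<close>

lemma has_bochner_integral_power_exp_scaled:
  fixes b :: real
  assumes "b > 0"
  shows "has_bochner_integral lborel (\<lambda>x. indicator {0<..} x *\<^sub>R (x ^ k * exp (- (b * x)))) (fact k / b ^ Suc k)"
proof -
  have "has_bochner_integral lborel
      (\<lambda>x. (0 + b * x) ^ k * exp (- (0 + b * x)) * indicator {0<..} (0 + b * x)) (fact k /\<^sub>R \<bar>b\<bar>)"
    using lborel_has_bochner_integral_real_affine_iff[of b "\<lambda>x. x ^ k * exp (- x) * indicator {0<..} x" "fact k" 0]
      has_bochner_integral_I0i_power_exp_m[of k] assms by simp
  from has_bochner_integral_divide_zero[OF this, of "b ^ k"]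
  have "has_bochner_integral lborel
      (\<lambda>x. (0 + b * x) ^ k * exp (- (0 + b * x)) * indicator {0<..} (0 + b * x) / b ^ k) (fact k / b ^ Suc k)"
    using assms by (simp add: field_simps)
  also have "(\<lambda>x. (0 + b * x) ^ k * exp (- (0 + b * x)) * indicator {0<..} (0 + b * x) / b ^ k)
      = (\<lambda>x. indicator {0<..} x *\<^sub>R (x ^ k * exp (- (b * x))))"
    using assms by (auto simp: fun_eq_iff indicator_def power_mult_distrib zero_less_mult_iff)
  finally show ?thesis .
qed

lemma cosh_mult_le_cosh:
  fixes t v :: real
  assumes "t \<in> {0..1}" "v > 0"
  shows "cosh (t * v) \<le> cosh v"
  using assms by (intro cosh_real_nonneg_le_iff[THEN iffD2]) (auto simp: mult_left_le_one_le)

text \<open>The common integrable majorant for the Fubini arguments. It holds uniformly in \<open>t\<close>, including \<open>t = 1\<close>,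
  because \<open>k \<ge> 1\<close> leaves a factor \<open>1 / (1 + cosh v)\<close> after \<open>cosh (t v)\<close> has been absorbed.\<close>

lemma cosh_div_power_le:
  fixes t v :: real
  assumes "t \<in> {0..1}" "v > 0" "k \<ge> 1"
  shows "cosh (t * v) * (fact k / (1 + cosh v) ^ Suc k) \<le> 2 * fact k * exp (- v)"
proof -
  define b where "b = 1 + cosh v"
  have b1: "b \<ge> 1" using cosh_real_nonneg[of v] by (simp add: b_def)
  have "cosh (t * v) \<le> b" using cosh_mult_le_cosh[OF assms(1,2)] by (simp add: b_def)
  then have "cosh (t * v) * (fact k / b ^ Suc k) \<le> b * (fact k / b ^ Suc k)"
    using b1 by (intro mult_right_mono) auto
  also have "\<dots> = fact k / b ^ k" using b1 by simp
  also have "\<dots> \<le> fact k / b ^ 1"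
    using b1 assms(3) by (intro divide_left_mono power_increasing mult_pos_pos zero_less_power) auto
  also have "\<dots> \<le> fact k / (exp v / 2)"
  proof -
    have "exp v / 2 \<le> b"
      unfolding b_def
      using cosh_plus_sinh[of v] sinh_le_cosh_real[of v] cosh_real_pos[of v] by linarith
    then show ?thesis
      using b1 by (intro divide_left_mono) auto
  qed
  also have "\<dots> = 2 * fact k * exp (- v)" by (simp add: exp_minus field_simps)
  finally show ?thesis unfolding b_def .
qed

lemma integrable_exp_minus: "integrable lborel (\<lambda>v. c * (indicator {0<..} v *\<^sub>R exp (- v)) :: real)"
  using has_bochner_integral_power_exp_scaled[of 1 0]
  unfolding has_bochner_integral_iff by simp

lemma measurable_cosh [measurable]: "(cosh :: real \<Rightarrow> real) \<in> borel_measurable borel"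
  by (intro borel_measurable_continuous_onI continuous_intros)

lemma measurable_sinh [measurable]: "(sinh :: real \<Rightarrow> real) \<in> borel_measurable borel"
  by (intro borel_measurable_continuous_onI continuous_intros)

text \<open>Removing the endpoint 0 changes nothing and keeps the later division by \<open>v\<close> meaningful.\<close>

lemma bessel_K_eq: "bessel_K t x = (\<integral>v. indicator {0<..} v * (exp (- x * cosh v) * cosh (t * v)) \<partial>lborel)"
  unfolding bessel_K_def set_lebesgue_integral_def
  using AE_lborel_singleton[of 0]
  by (intro integral_cong_AE) (auto split: split_indicator)

text \<open>The integrand of the inner double integral, after inserting the integral for \<open>K\<^sub>t\<close>; the factors
  depending only on \<open>v\<close> are separated so that the \<open>x\<close>-integral is a Laplace transform.\<close>

definition bessel_integrand :: "(real \<Rightarrow> real) \<Rightarrow> real \<Rightarrow> real \<Rightarrow> real \<Rightarrow> real" where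
  "bessel_integrand f t v x = (indicator {0<..} v * cosh (t * v)) *
     (indicator {0<..} x *\<^sub>R (f x * exp (- ((1 + cosh v) * x))))"

lemma integrable_bessel_integrand_power:
  assumes "t \<in> {0..1}" "k \<ge> 1"
  shows "integrable (lborel \<Otimes>\<^sub>M lborel) (\<lambda>(v, x). bessel_integrand (\<lambda>x. x ^ k) t v x)"
proof (rule lborel_pair.Fubini_integrable)
  show "(\<lambda>(v, x). bessel_integrand (\<lambda>x. x ^ k) t v x) \<in> borel_measurable (lborel \<Otimes>\<^sub>M lborel)"
    unfolding bessel_integrand_def by measurable
  have hb: "has_bochner_integral lborel (\<lambda>x. indicator {0<..} x *\<^sub>R (x ^ k * exp (- ((1 + cosh v) * x))))
      (fact k / (1 + cosh v) ^ Suc k)" for v :: real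
    by (rule has_bochner_integral_power_exp_scaled[OF one_plus_cosh_pos])
  show "AE v in lborel. integrable lborel (\<lambda>x. case (v, x) of (v, x) \<Rightarrow> bessel_integrand (\<lambda>x. x ^ k) t v x)"
    using has_bochner_integral_mult_right[OF hb]
    unfolding bessel_integrand_def has_bochner_integral_iff by auto
  have nrm: "norm (bessel_integrand (\<lambda>x. x ^ k) t v x) = bessel_integrand (\<lambda>x. x ^ k) t v x" for v x
    unfolding bessel_integrand_def by (auto split: split_indicator simp: abs_mult)
  have eq: "(\<integral>x. norm (bessel_integrand (\<lambda>x. x ^ k) t v x) \<partial>lborel)
      = indicator {0<..} v * cosh (t * v) * (fact k / (1 + cosh v) ^ Suc k)" for v
    unfolding nrm unfolding bessel_integrand_def
    using has_bochner_integral_mult_right[OF hb] unfolding has_bochner_integral_iff by blast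
  have "integrable lborel (\<lambda>v. indicator {0<..} v * cosh (t * v) * (fact k / (1 + cosh v) ^ Suc k))"
  proof (rule Bochner_Integration.integrable_bound[OF integrable_exp_minus[of "2 * fact k"]])
    show "AE v in lborel. norm (indicator {0<..} v * cosh (t * v) * (fact k / (1 + cosh v) ^ Suc k))
        \<le> norm (2 * fact k * (indicator {0<..} v *\<^sub>R exp (- v)) :: real)"
      using cosh_div_power_le[OF assms(1) _ assms(2)] one_plus_cosh_pos
      by (intro AE_I2) (auto split: split_indicator simp: abs_mult less_imp_le)
  qed measurable
  then show "integrable lborel (\<lambda>v. \<integral>x. norm (case (v, x) of (v, x) \<Rightarrow> bessel_integrand (\<lambda>x. x ^ k) t v x) \<partial>lborel)"
    by (simp only: prod.case eq)
qed

lemma p_fun_eq_sum_pos: "n \<ge> 1 \<Longrightarrow> p_fun n x = (\<Sum>k\<in>{1..n}. p_coeff n k * x ^ k)"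
  unfolding p_fun_eq_sum
  by (intro sum.mono_neutral_right) (auto simp: not_le less_Suc_eq gr0_conv_Suc p_coeff_at_0)

lemma bessel_integrand_p_fun:
  "n \<ge> 1 \<Longrightarrow> bessel_integrand (p_fun n) t v x
     = (\<Sum>k\<in>{1..n}. p_coeff n k * bessel_integrand (\<lambda>x. x ^ k) t v x)"
  unfolding bessel_integrand_def p_fun_eq_sum_pos real_scaleR_def sum_distrib_left sum_distrib_right
  by (intro sum.cong) (auto simp: mult_ac)

lemma laplace_p_integral:
  "(\<integral>x. bessel_integrand (p_fun n) t v x \<partial>lborel) = indicator {0<..} v * cosh (t * v) * laplace_p n v"
proof -
  have "has_bochner_integral lborel (\<lambda>x. \<Sum>k\<le>n. p_coeff n k *
        (indicator {0<..} x *\<^sub>R (x ^ k * exp (- ((1 + cosh v) * x))))) (laplace_p n v)"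
    unfolding laplace_p_def
    by (intro has_bochner_integral_sum has_bochner_integral_mult_right
        has_bochner_integral_power_exp_scaled one_plus_cosh_pos)
  then have "has_bochner_integral lborel (\<lambda>x. (indicator {0<..} v * cosh (t * v)) * (\<Sum>k\<le>n. p_coeff n k *
        (indicator {0<..} x *\<^sub>R (x ^ k * exp (- ((1 + cosh v) * x))))))
        ((indicator {0<..} v * cosh (t * v)) * laplace_p n v)"
    by (rule has_bochner_integral_mult_right)
  also have "(\<lambda>x. (indicator {0<..} v * cosh (t * v)) * (\<Sum>k\<le>n. p_coeff n k *
        (indicator {0<..} x *\<^sub>R (x ^ k * exp (- ((1 + cosh v) * x))))))
      = bessel_integrand (p_fun n) t v"
    unfolding bessel_integrand_def p_fun_eq_sum real_scaleR_def sum_distrib_left sum_distrib_right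
    by (intro ext sum.cong) (auto simp: mult_ac)
  finally show ?thesis by (simp add: has_bochner_integral_iff)
qed

lemma bessel_K_p_integral:
  assumes "n \<ge> 1" "t \<in> {0..1}"
  shows "(LBINT x:{0<..}. bessel_K t x * exp (- x) * p_fun n x)
     = (\<integral>v. indicator {0<..} v * cosh (t * v) * laplace_p n v \<partial>lborel)"
proof -
  have int: "integrable (lborel \<Otimes>\<^sub>M lborel) (\<lambda>(v, x). bessel_integrand (p_fun n) t v x)"
    using assms
    by (simp add: bessel_integrand_p_fun split_def)
       (auto intro!: Bochner_Integration.integrable_sum integrable_mult_right 
         integrable_bessel_integrand_power[unfolded split_def])
  have "(LBINT x:{0<..}. bessel_K t x * exp (- x) * p_fun n x)
      = (\<integral>x. (\<integral>v. bessel_integrand (p_fun n) t v x \<partial>lborel) \<partial>lborel)"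
    unfolding set_lebesgue_integral_def
  proof (rule Bochner_Integration.integral_cong[OF refl])
    fix x :: real
    have "indicator {0<..} x *\<^sub>R (bessel_K t x * exp (- x) * p_fun n x)
       = (\<integral>v. indicator {0<..} v * (exp (- x * cosh v) * cosh (t * v)) \<partial>lborel) *
          (indicator {0<..} x * exp (- x) * p_fun n x)"
      unfolding bessel_K_eq by (simp add: mult_ac)
    also have "\<dots> = (\<integral>v. indicator {0<..} v * (exp (- x * cosh v) * cosh (t * v)) *
          (indicator {0<..} x * exp (- x) * p_fun n x) \<partial>lborel)"
      by (rule integral_mult_left_zero [symmetric])
    also have "(\<lambda>v. indicator {0<..} v * (exp (- x * cosh v) * cosh (t * v)) *
          (indicator {0<..} x * exp (- x) * p_fun n x)) = (\<lambda>v. bessel_integrand (p_fun n) t v x)"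
      by (auto simp: fun_eq_iff bessel_integrand_def ring_distribs exp_add exp_diff exp_minus divide_inverse mult_ac)
    finally show "indicator {0<..} x *\<^sub>R (bessel_K t x * exp (- x) * p_fun n x)
       = (\<integral>v. bessel_integrand (p_fun n) t v x \<partial>lborel)" .
  qed
  also have "\<dots> = (\<integral>v. (\<integral>x. bessel_integrand (p_fun n) t v x \<partial>lborel) \<partial>lborel)"
    by (rule lborel_pair.Fubini_integral[OF int])
  finally show ?thesis unfolding laplace_p_integral .
qed

text \<open>Integrating over \<open>t\<close> turns \<open>cosh (t v)\<close> into \<open>sinh v / v\<close>. The factor \<open>sinh v\<close> completes the Laplace
  transform to the derivative of \<open>tanh (v/2)\<close>.\<close>

lemma cosh_integral_unit:
  fixes v :: real
  assumes "v > 0"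
  shows "has_bochner_integral lborel (\<lambda>t. indicator {0..1} t *\<^sub>R cosh (t * v)) (sinh v / v)"
proof -
  have "has_bochner_integral lborel (\<lambda>t. cosh (t * v) * indicator {0..1} t) (sinh (1 * v) / v - sinh (0 * v) / v)"
    using assms
    by (intro has_bochner_integral_FTC_Icc_real) (auto intro!: derivative_eq_intros continuous_intros)
  then show ?thesis by (simp add: mult.commute)
qed

lemma bessel_double_integral:
  assumes "n \<ge> 1"
  shows "(LBINT t:{0..1}. (LBINT x:{0<..}. bessel_K t x * exp (- x) * p_fun n x))
     = (\<integral>v. indicator {0<..} v *\<^sub>R (tanh_kernel n v / v) \<partial>lborel)"
proof -
  define f :: "real \<Rightarrow> real \<Rightarrow> real" where
    "f = (\<lambda>v t. (indicator {0<..} v * laplace_p n v) * (indicator {0..1} t *\<^sub>R cosh (t * v)))"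
  have hb: "has_bochner_integral lborel (f v) (indicator {0<..} v *\<^sub>R (tanh_kernel n v / v))" for v
  proof (cases "v > 0")
    case True
    from has_bochner_integral_mult_right[OF cosh_integral_unit[OF this], of "indicator {0<..} v * laplace_p n v"] 
    show ?thesis
      using True by (simp add: f_def tanh_kernel_def mult_ac)
  qed (simp add: f_def has_bochner_integral_zero)
  have hbn: "has_bochner_integral lborel (\<lambda>t. norm (f v t)) \<bar>indicator {0<..} v *\<^sub>R (tanh_kernel n v / v)\<bar>" for v
  proof (cases "v > 0")
    case True
    from has_bochner_integral_mult_right[OF cosh_integral_unit[OF this], of "\<bar>laplace_p n v\<bar>"] 
    show ?thesis
      using True by (simp add: f_def tanh_kernel_def abs_mult mult_ac)
  qed (simp add: f_def has_bochner_integral_zero)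
  have meas_L[measurable]: "laplace_p n \<in> borel_measurable borel"
    unfolding laplace_p_def by measurable
  have meas_K[measurable]: "tanh_kernel n \<in> borel_measurable borel"
    unfolding tanh_kernel_def by measurable
  define C where "C = (\<Sum>k\<le>n. \<bar>p_coeff n k\<bar> * (2 * fact k))"
  have bound: "\<bar>tanh_kernel n v / v\<bar> \<le> C * exp (- v)" if "v > 0" for v
  proof -
    have L: "\<bar>laplace_p n v\<bar> * cosh v \<le> C * exp (- v)"
    proof -
      have "\<bar>laplace_p n v\<bar> * cosh v \<le> (\<Sum>k\<le>n. \<bar>p_coeff n k * (fact k / (1 + cosh v) ^ Suc k)\<bar>) * cosh v"
        unfolding laplace_p_def by (intro mult_right_mono sum_abs) simp
      also have "\<dots> = (\<Sum>k\<le>n. \<bar>p_coeff n k\<bar> * (cosh (1 * v) * (fact k / (1 + cosh v) ^ Suc k)))"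
        unfolding sum_distrib_right using one_plus_cosh_pos[of v]
        by (intro sum.cong) (auto simp: abs_mult)
      also have "\<dots> \<le> (\<Sum>k\<le>n. \<bar>p_coeff n k\<bar> * (2 * fact k * exp (- v)))"
      proof (intro sum_mono)
        fix k
        show "\<bar>p_coeff n k\<bar> * (cosh (1 * v) * (fact k / (1 + cosh v) ^ Suc k))
            \<le> \<bar>p_coeff n k\<bar> * (2 * fact k * exp (- v))"
        proof (cases "k = 0")
          case True
          then show ?thesis using assms by (cases n) simp_all
        next
          case False
          then show ?thesis using that by (intro mult_left_mono cosh_div_power_le) auto
        qed
      qed
      also have "\<dots> = C * exp (- v)" by (simp add: C_def sum_distrib_right mult.assoc)
      finally show ?thesis .
    qed
    have "sinh v / v \<le> cosh v"
    proof -
      have "sinh v / v = (\<integral>t. indicator {0..1} t *\<^sub>R cosh (t * v) \<partial>lborel)"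
        using cosh_integral_unit[OF that] by (simp add: has_bochner_integral_iff)
      also have "\<dots> \<le> (\<integral>t. indicator {0..1::real} t *\<^sub>R cosh v \<partial>lborel)"
        using cosh_integral_unit[OF that] cosh_mult_le_cosh[OF _ that]
        by (intro Bochner_Integration.integral_mono) (auto simp: has_bochner_integral_iff split: split_indicator)
      finally show ?thesis by simp
    qed
    then have "\<bar>laplace_p n v\<bar> * (sinh v / v) \<le> \<bar>laplace_p n v\<bar> * cosh v"
      by (intro mult_left_mono) auto
    moreover have "\<bar>tanh_kernel n v / v\<bar> = \<bar>laplace_p n v\<bar> * (sinh v / v)"
      using that by (simp add: tanh_kernel_def abs_mult mult_ac)
    ultimately show ?thesis using L by linarith
  qed
  have int: "integrable (lborel \<Otimes>\<^sub>M lborel) (\<lambda>(v, t). f v t)"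
  proof (rule lborel_pair.Fubini_integrable)
    show "(\<lambda>(v, t). f v t) \<in> borel_measurable (lborel \<Otimes>\<^sub>M lborel)"
      unfolding f_def by measurable
    show "AE v in lborel. integrable lborel (\<lambda>t. case (v, t) of (v, t) \<Rightarrow> f v t)"
      using hb by (simp add: has_bochner_integral_iff)
    have "integrable lborel (\<lambda>v. \<bar>indicator {0<..} v *\<^sub>R (tanh_kernel n v / v)\<bar>)"
      by (rule Bochner_Integration.integrable_bound[OF integrable_exp_minus[of C]])
         (use bound in \<open>auto split: split_indicator intro: order_trans[OF _ abs_ge_self]\<close>)
    then show "integrable lborel (\<lambda>v. \<integral>t. norm (case (v, t) of (v, t) \<Rightarrow> f v t) \<partial>lborel)"
      using hbn by (simp add: has_bochner_integral_iff)
  qed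
  have "(LBINT t:{0..1}. (LBINT x:{0<..}. bessel_K t x * exp (- x) * p_fun n x))
     = (\<integral>t. (\<integral>v. f v t \<partial>lborel) \<partial>lborel)"
    unfolding set_lebesgue_integral_def [where A = "{0..1}"]
  proof (rule Bochner_Integration.integral_cong[OF refl])
    fix t :: real
    show "indicator {0..1} t *\<^sub>R (LBINT x:{0<..}. bessel_K t x * exp (- x) * p_fun n x) = (\<integral>v. f v t \<partial>lborel)"
      using bessel_K_p_integral[OF assms, of t]
      by (cases "t \<in> {0..1}") (simp_all add: f_def mult_ac)
  qed
  also have "\<dots> = (\<integral>v. (\<integral>t. f v t \<partial>lborel) \<partial>lborel)"
    by (rule lborel_pair.Fubini_integral[OF int])
  also have "(\<lambda>v. \<integral>t. f v t \<partial>lborel) = (\<lambda>v. indicator {0<..} v *\<^sub>R (tanh_kernel n v / v))"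
    using hb by (simp add: has_bochner_integral_iff)
  finally show ?thesis .
qed

section \<open>Summation over the poles\<close>

text \<open>Termwise integration of the partial fraction series. Pointwise and in mean the terms are dominated by a
  multiple of \<open>1 / (k + 1)\<^sup>2\<close>, since \<open>n \<ge> 1\<close>.\<close>

lemma tanh_kernel_integral:
  assumes "n \<ge> 1"
  shows "(\<lambda>k. 4 * fact (2 * n) * ((-1) ^ n * (pi / 2) / (real (2 * k + 1) * pi) ^ (2 * n + 1)))
     sums (\<integral>v. indicator {0<..} v *\<^sub>R (tanh_kernel n v / v) \<partial>lborel)"
proof -
  define a where "a = (\<lambda>k. real (2 * k + 1) * pi)"
  have a: "a k > 0" "a k \<ge> real (Suc k)" for k using odd_pi_ge[of k] by (auto simp: a_def)
  define f where "f = (\<lambda>k v. 4 * fact (2 * n) * (indicator {0<..} v *\<^sub>R pole_integrand (2 * n + 1) (a k) v))"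
  have hb: "has_bochner_integral lborel (f k) (4 * fact (2 * n) * ((-1) ^ n * (pi / 2) / a k ^ (2 * n + 1)))" for k
    unfolding f_def by (intro has_bochner_integral_mult_right pole_integrand_integral a)
  define N where "N = (\<integral>v. norm (indicator {0<..} v *\<^sub>R pole_integrand (2 * n + 1) 1 v) \<partial>lborel)"
  have N: "N \<ge> 0" unfolding N_def by (intro Bochner_Integration.integral_nonneg) auto
  have nrm: "(\<integral>v. norm (f k v) \<partial>lborel) = 4 * fact (2 * n) * (N / a k ^ (2 * n + 1))" for k
    unfolding f_def norm_mult using pole_integrand_integral(2)[OF a(1), of n k] by (simp add: N_def)
  have "(\<lambda>k. integral\<^sup>L lborel (f k)) sums (\<integral>v. (\<Sum>k. f k v) \<partial>lborel)"
  proof (rule sums_integral)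
    show "integrable lborel (f k)" for k using hb by (simp add: has_bochner_integral_iff)
    show "AE v in lborel. summable (\<lambda>k. norm (f k v))"
    proof (intro AE_I2)
      fix v :: real
      have "norm (norm (f k v)) \<le> (4 * fact (2 * n) * \<bar>1 / v\<bar>) * (1 / real (Suc k) ^ 2)" for k
      proof (cases "v > 0")
        case True
        then have "norm (norm (f k v)) = (4 * fact (2 * n) * \<bar>1 / v\<bar>) * \<bar>Re (1 / Complex v (- a k) ^ (2 * n + 1))\<bar>"
          by (simp add: f_def pole_integrand_def abs_mult)
        also have "\<dots> \<le> (4 * fact (2 * n) * \<bar>1 / v\<bar>) * (1 / real (Suc k) ^ 2)"
          unfolding a_def using assms by (intro mult_left_mono pole_term_bound) auto
        finally show ?thesis .
      next
        case False
        then have "norm (norm (f k v)) = 0" by (simp add: f_def)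
        then show ?thesis by simp
      qed
      then show "summable (\<lambda>k. norm (f k v))"
        by (intro summable_comparison_test'[OF summable_mult[OF summable_inverse_Suc_square]]) 
    qed
    show "summable (\<lambda>k. \<integral>v. norm (f k v) \<partial>lborel)"
      unfolding nrm
    proof (intro summable_mult, rule summable_comparison_test'[OF summable_mult[OF summable_inverse_Suc_square, of N]])
      fix k
      have "real (Suc k) ^ 2 \<le> a k ^ 2" using a[of k] by (intro power_mono) auto
      also have "\<dots> \<le> a k ^ (2 * n + 1)"
        using assms order_trans[OF _ a(2)[of k], of 1] by (intro power_increasing) auto
      finally show "norm (N / a k ^ (2 * n + 1)) \<le> N * (1 / real (Suc k) ^ 2)"
        using N a(1)[of k] by (simp add: frac_le)
    qed
  qed
  also have "(\<lambda>k. integral\<^sup>L lborel (f k)) = (\<lambda>k. 4 * fact (2 * n) * ((-1) ^ n * (pi / 2) / a k ^ (2 * n + 1)))"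
    using hb by (simp add: has_bochner_integral_iff)
  also have "(\<lambda>v. \<Sum>k. f k v) = (\<lambda>v. indicator {0<..} v *\<^sub>R (tanh_kernel n v / v))"
  proof
    fix v
    have s: "summable (\<lambda>k. Re (1 / Complex v (- a k) ^ (2 * n + 1)))"
      unfolding a_def by (rule summable_pole_sum) simp
    have "(\<Sum>k. f k v) = (\<Sum>k. (4 * fact (2 * n) * indicator {0<..} v / v) * Re (1 / Complex v (- a k) ^ (2 * n + 1)))"
      by (simp add: f_def pole_integrand_def mult_ac)
    also have "\<dots> = (4 * fact (2 * n) * indicator {0<..} v / v) * pole_sum (2 * n + 1) v"
      unfolding pole_sum_def using suminf_mult[OF s] unfolding a_def by blast
    finally show "(\<Sum>k. f k v) = indicator {0<..} v *\<^sub>R (tanh_kernel n v / v)"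
      by (simp add: tanh_kernel_eq_pole_sum mult_ac)
  qed
  finally show ?thesis unfolding a_def .
qed

lemma zeta_sums:
  assumes "s \<ge> 2"
  shows "(\<lambda>k. 1 / real (Suc k) ^ s) sums zeta (real s)"
proof -
  have "summable (\<lambda>k. 1 / real (Suc k) ^ s)"
    using inverse_power_summable[of s, where 'a = real] assms
    by (subst summable_Suc_iff) (simp add: inverse_eq_divide)
  then show ?thesis unfolding zeta_def by (simp add: powr_realpow summable_sums del: of_nat_Suc)
qed

text \<open>Grouping the zeta series into consecutive pairs: the even-indexed summands \<open>1 / (2k + 2)\<^sup>s\<close> add up to
  \<open>\<zeta>(s) / 2\<^sup>s\<close>.\<close>

lemma odd_zeta_sums:
  assumes "s \<ge> 2"
  shows "(\<lambda>k. 1 / real (2 * k + 1) ^ s) sums ((1 - 1 / 2 ^ s) * zeta (real s))"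
proof -
  have "(\<lambda>k. sum (\<lambda>k. 1 / real (Suc k) ^ s) {k * 2..<k * 2 + 2}) sums zeta (real s)"
    by (rule sums_group[OF zeta_sums[OF assms]]) simp
  also have "(\<lambda>k. sum (\<lambda>k. 1 / real (Suc k) ^ s) {k * 2..<k * 2 + 2})
      = (\<lambda>k. 1 / real (2 * k + 1) ^ s + 1 / 2 ^ s * (1 / real (Suc k) ^ s))"
  proof
    fix k :: nat
    have "{k * 2..<k * 2 + 2} = {2 * k, 2 * k + 1}" by auto
    moreover have "real (Suc (2 * k + 1)) = 2 * real (Suc k)" by simp
    ultimately show "sum (\<lambda>k. 1 / real (Suc k) ^ s) {k * 2..<k * 2 + 2}
      = 1 / real (2 * k + 1) ^ s + 1 / 2 ^ s * (1 / real (Suc k) ^ s)"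
      by (simp add: power_mult_distrib del: of_nat_Suc)
  qed
  finally have "(\<lambda>k. 1 / real (2 * k + 1) ^ s + 1 / 2 ^ s * (1 / real (Suc k) ^ s)) sums zeta (real s)" .
  from sums_diff[OF this sums_mult[OF zeta_sums[OF assms], of "1 / 2 ^ s"]]
  show ?thesis by (simp add: algebra_simps)
qed

theorem mainTheorem11:
  fixes n :: nat
  assumes "n \<ge> 1"
  shows "(-1) ^ n * fact (2 * n) * (2 ^ (2 * n + 1) - 1) * (zeta (real (2 * n + 1)) / (2 * pi) ^ (2 * n))
    = (LBINT t:{0..1}. (LBINT x:{0<..}. bessel_K t x * exp (- x) * p_fun n x))"
proof -
  define Z where "Z = zeta (real (2 * n + 1))"
  define c where "c = 4 * fact (2 * n) * (-1) ^ n * (pi / 2) / pi ^ (2 * n + 1)"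
  have "(\<lambda>k. c * (1 / real (2 * k + 1) ^ (2 * n + 1))) sums (c * ((1 - 1 / 2 ^ (2 * n + 1)) * Z))"
    unfolding Z_def using assms by (intro sums_mult odd_zeta_sums) auto
  also have "(\<lambda>k. c * (1 / real (2 * k + 1) ^ (2 * n + 1)))
      = (\<lambda>k. 4 * fact (2 * n) * ((-1) ^ n * (pi / 2) / (real (2 * k + 1) * pi) ^ (2 * n + 1)))"
    by (auto simp: c_def power_mult_distrib mult_ac)
  finally have "(LBINT t:{0..1}. (LBINT x:{0<..}. bessel_K t x * exp (- x) * p_fun n x))
      = c * ((1 - 1 / 2 ^ (2 * n + 1)) * Z)"
    using sums_unique2[OF tanh_kernel_integral[OF assms]] bessel_double_integral[OF assms] by simp
  also have "\<dots> = (-1) ^ n * fact (2 * n) * (2 ^ (2 * n + 1) - 1) * (Z / (2 * pi) ^ (2 * n))"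
    unfolding c_def power_mult_distrib by (simp add: field_simps)
  finally show ?thesis unfolding Z_def by simp
qed

end
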